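(* If $g_1,g_2\in\mathbf G$ are contained in the same double coset of $\mathbf K\setminus\mathbf G/\mathbf K$, then $\chi_{g_1}(Q,T)=\chi_{g_2}(Q,T)$ for all self-dual submodules $Q,T\subset\mathcal H$.
   Context: Let $p$ be a prime, $\alpha\ge 0$ and $k\ge 1$ integers. $\mathbf G=\mathrm{GL}(\alpha+k\infty,\mathbb Q_p)$ is the group of finitary ($g-1$ has finitely many nonzero entries) invertible block matrices over $\mathbb Q_p$ of size $\alpha+\infty+\dots+\infty$ ($k$ copies of $\infty=\mathbb N$). It is the union of the subgroups $\mathrm{GL}(\alpha+km,\mathbb Q_p)$, where in each of the $k$ infinite blocks only the first $m$ coordinates are involved. $\mathrm O(\infty,\mathbb Z_p)$ is the group of finitary infinite orthogonal matrices with entries in $\mathbb Z_p$, embedded in $\mathbf G$ by $\mathfrak I(u)=\mathrm{diag}(1_\alpha,u,\dots,u)$; its image is $\mathbf K$. A submodule means a $\mathbb Z_p$-submodule of a finite-dimensional $\mathbb Q_p$-space. If $V$ carries a nondegenerate skew-symmetric bilinear form $B$, a submodule $R\subset V$ is isotropic if $B(v,w)\in\mathbb Z_p$ for all $v,w\in R$, and self-dual if it is maximal isotropic (equivalently, $R=\{w: B(v,w)\in\mathbb Z_p\ \forall v\in R\}$). $\mathcal V=\mathbb Q_p^\alpha\oplus\mathbb Q_p^\alpha$ and $\mathcal H=\mathbb Q_p^k\oplus\mathbb Q_p^k$ carry the standard skew-symmetric forms with matrix $\begin{pmatrix}0&1\\ -1&0\end{pmatrix}$. A vector $x=(x_1^+,\dots,x_k^+,x_1^-,\dots,x_k^-)$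 with $x_j^\pm\in\mathbb Q_p^m$ is regarded as an element of $\mathcal H\otimes\mathbb Q_p^m$; for a submodule $Q\subset\mathcal H$, $Q\otimes\mathbb Z_p^m\subset\mathcal H\otimes\mathbb Q_p^m$ is the direct sum of $m$ copies of $Q$, i.e. the set of $x$ such that for each $i=1,\dots,m$ the vector of $i$-th coordinates $(x_{1,i}^+,\dots,x_{k,i}^+,x_{1,i}^-,\dots,x_{k,i}^-)$ lies in $Q$. Characteristic function: let $g\in\mathrm{GL}(\alpha+km,\mathbb Q_p)\subset\mathbf G$ and let $Q,T\subset\mathcal H$ be self-dual submodules. $\chi_g(Q,T)\subset\mathcal V\oplus\mathcal V$ is the set of all $u\oplus v$, $u=u^+\oplus u^-$, $v=v^+\oplus v^-$, for which there exist $x\in Q\otimes\mathbb Z_p^m$, $y\in T\otimes\mathbb Z_p^m$ with $$\begin{pmatrix}v^+\\ y^+\end{pmatrix}=g\begin{pmatrix}u^+\\ x^+\end{pmatrix},\qquad \begin{pmatrix}v^-\\ y^-\end{pmatrix}=(g^t)^{-1}\begin{pmatrix}u^-\\ x^-\end{pmatrix},$$ where $x^\pm=(x_1^\pm,\dots,x_k^\pm)$, $y^\pm=(y_1^\pm,\dots,y_k^\pm)$ are columns. It does not depend on the choice of $m$. *)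

theory Defs
  imports
    "HOL-Algebra.Coset"
    "HOL-Computational_Algebra.Fraction_Field"
    "HOL-Library.Groups_Big_Fun"
    "Jordan_Normal_Form.Matrix"
    "Berlekamp_Zassenhaus.Finite_Field"
begin

section \<open>The $p$-adic numbers\<close>

text \<open>
  The prime $p$ is the cardinality of a type of class \<^class>\<open>prime_card\<close>, so that a statement with
  a free type variable \<open>'p\<close> is a statement about all primes $p$.  The ring $Z_p$ is
  the inverse limit of the rings $Z/p^n$, whose residue classes are represented by
  $0, \dots, p^n - 1$, and $Q_p$ is its field of fractions.
\<close>

typedef (overloaded) ('p::prime_card) padic_int =
  "{f :: nat \<Rightarrow> int. \<forall>n. f (Suc n) mod int CARD('p) ^ n = f n}"
  by (rule exI[of _ "\<lambda>_. 0"]) simp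

setup_lifting type_definition_padic_int

lemma coherent_mod:
  fixes f :: "nat \<Rightarrow> int"
  assumes "\<forall>n. f (Suc n) mod q ^ n = f n"
  shows "f n mod q ^ n = f n"
proof -
  have "f (Suc n) mod q ^ n mod q ^ n = f (Suc n) mod q ^ n" by simp
  thus ?thesis using assms by simp
qed

lemma mod_power_Suc: "x mod q ^ Suc n mod q ^ n = x mod (q ^ n :: int)"
  by (rule mod_mod_cancel) simp

lemma coherent_step: "y mod q = x \<Longrightarrow> y mod q = x mod (q :: int)"
  by auto

instantiation padic_int :: (prime_card) comm_ring_1
begin

lift_definition zero_padic_int :: "'a padic_int" is "\<lambda>_. 0" by simp

lift_definition one_padic_int :: "'a padic_int" is "\<lambda>n. 1 mod int CARD('a) ^ n"
  by (rule mod_power_Suc)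

lift_definition plus_padic_int :: "'a padic_int \<Rightarrow> 'a padic_int \<Rightarrow> 'a padic_int"
  is "\<lambda>f g n. (f n + g n) mod int CARD('a) ^ n"
  by (subst mod_power_Suc, intro mod_add_cong coherent_step; assumption)

lift_definition uminus_padic_int :: "'a padic_int \<Rightarrow> 'a padic_int"
  is "\<lambda>f n. (- f n) mod int CARD('a) ^ n"
  by (subst mod_power_Suc, intro mod_minus_cong coherent_step; assumption)

lift_definition minus_padic_int :: "'a padic_int \<Rightarrow> 'a padic_int \<Rightarrow> 'a padic_int"
  is "\<lambda>f g n. (f n - g n) mod int CARD('a) ^ n"
  by (subst mod_power_Suc, intro mod_diff_cong coherent_step; assumption)

lift_definition times_padic_int :: "'a padic_int \<Rightarrow> 'a padic_int \<Rightarrow> 'a padic_int"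
  is "\<lambda>f g n. (f n * g n) mod int CARD('a) ^ n"
  by (subst mod_power_Suc, intro mod_mult_cong coherent_step; assumption)

instance
proof
  fix a b c :: "'a padic_int"
  show "a * b * c = a * (b * c)" by transfer (simp add: mod_simps mult.assoc)
  show "a * b = b * a" by transfer (simp add: mult.commute)
  show "1 * a = a"
    by transfer (rule ext, simp add: mod_simps coherent_mod)
  show "a + b + c = a + (b + c)" by transfer (simp add: mod_simps add.assoc)
  show "a + b = b + a" by transfer (simp add: add.commute)
  show "0 + a = a" by transfer (rule ext, simp add: coherent_mod)
  show "- a + a = 0" by transfer (simp add: mod_simps)
  show "a - b = a + - b" by transfer (simp add: mod_simps)
  show "(a + b) * c = a * c + b * c" by transfer (simp add: mod_simps distrib_right)
  show "(0::'a padic_int) \<noteq> 1"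
  proof
    assume "(0::'a padic_int) = 1"
    hence "(\<lambda>_. 0) = (\<lambda>n. 1 mod int CARD('a) ^ n)" by transfer
    hence "(0::int) = 1 mod int CARD('a) ^ 1" by (rule fun_cong)
    moreover have "1 < int CARD('a)"
      using prime_gt_1_nat[OF prime_card[where 'a = 'a]] by simp
    ultimately show False by simp
  qed
qed

end

lemma coherent_trunc:
  fixes f :: "nat \<Rightarrow> int"
  assumes "\<forall>n. f (Suc n) mod q ^ n = f n"
  shows "f (n + k) mod q ^ n = f n"
proof (induction k)
  case 0
  show ?case using coherent_mod[OF assms] by simp
next
  case (Suc k)
  have "f (n + Suc k) mod q ^ n = (f (Suc (n + k)) mod q ^ (n + k)) mod q ^ n"
    by (simp add: mod_mod_cancel le_imp_power_dvd)
  also have "f (Suc (n + k)) mod q ^ (n + k) = f (n + k)" using assms by simp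
  finally show ?case using Suc by simp
qed

lemma prime_power_dvd_mult_split:
  fixes a b q :: int
  assumes "prime q" and "q ^ (n + m) dvd a * b"
  shows "q ^ n dvd a \<or> q ^ m dvd b"
proof (rule ccontr)
  assume "\<not> ?thesis"
  hence na: "\<not> q ^ n dvd a" and nb: "\<not> q ^ m dvd b" by auto
  hence "a \<noteq> 0" "b \<noteq> 0" by auto
  have q: "prime_elem q" "\<not> is_unit q" using assms(1) by auto
  have "multiplicity q a < n"
    by (rule multiplicity_lessI) (use na \<open>a \<noteq> 0\<close> q in auto)
  moreover have "multiplicity q b < m"
    by (rule multiplicity_lessI) (use nb \<open>b \<noteq> 0\<close> q in auto)
  moreover have "multiplicity q (a * b) = multiplicity q a + multiplicity q b"
    by (rule prime_elem_multiplicity_mult_distrib) (use q \<open>a \<noteq> 0\<close> \<open>b \<noteq> 0\<close> in auto)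
  moreover have "n + m \<le> multiplicity q (a * b)"
    by (rule multiplicity_geI) (use q \<open>a \<noteq> 0\<close> \<open>b \<noteq> 0\<close> assms(2) in auto)
  ultimately show False by simp
qed

instance padic_int :: (prime_card) idom
proof
  fix a b :: "'a padic_int"
  assume "a \<noteq> 0" "b \<noteq> 0"
  thus "a * b \<noteq> 0"
  proof transfer
    fix f g :: "nat \<Rightarrow> int"
    let ?q = "int CARD('a)"
    assume f: "\<forall>n. f (Suc n) mod ?q ^ n = f n" and g: "\<forall>n. g (Suc n) mod ?q ^ n = g n"
      and f0: "f \<noteq> (\<lambda>_. 0)" and g0: "g \<noteq> (\<lambda>_. 0)"
    have "\<exists>n. f n \<noteq> 0" "\<exists>m. g m \<noteq> 0" using f0 g0 by auto
    then obtain n m where nm: "f n \<noteq> 0" "g m \<noteq> 0" by blast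
    have "\<not> ?q ^ n dvd f (n + m)"
      using coherent_trunc[OF f, of n m] nm(1) by (simp add: dvd_eq_mod_eq_0)
    moreover have "\<not> ?q ^ m dvd g (n + m)"
      using coherent_trunc[OF g, of m n] nm(2) by (simp add: dvd_eq_mod_eq_0 add.commute)
    moreover have "prime ?q" using prime_card[where 'a = 'a] by simp
    ultimately have "\<not> ?q ^ (n + m) dvd f (n + m) * g (n + m)"
      using prime_power_dvd_mult_split by blast
    hence "f (n + m) * g (n + m) mod ?q ^ (n + m) \<noteq> 0" by (simp add: dvd_eq_mod_eq_0)
    thus "(\<lambda>n. f n * g n mod ?q ^ n) \<noteq> (\<lambda>_. 0)" by (metis (mono_tags))
  qed
qed

type_synonym 'p padic = "'p padic_int fract"

definition Zp :: "('p::prime_card) padic set" where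
  "Zp = range (\<lambda>a. Fract a 1)"


section \<open>Self-dual submodules\<close>

text \<open>
  An element $x^+ \oplus x^-$ of $Q_p^n \oplus Q_p^n$ is the pair $(x^+, x^-)$.
\<close>

definition double_space :: "nat \<Rightarrow> (('p::prime_card) padic vec \<times> 'p padic vec) set" where
  "double_space n = carrier_vec n \<times> carrier_vec n"

definition skew_form ::
    "('p::prime_card) padic vec \<times> 'p padic vec \<Rightarrow> 'p padic vec \<times> 'p padic vec \<Rightarrow> 'p padic" where
  "skew_form v w = fst v \<bullet> snd w - snd v \<bullet> fst w"

definition Zp_submodule :: "nat \<Rightarrow> (('p::prime_card) padic vec \<times> 'p padic vec) set \<Rightarrow> bool" where
  "Zp_submodule n R \<longleftrightarrow>
     R \<subseteq> double_space n \<and>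
     (0\<^sub>v n, 0\<^sub>v n) \<in> R \<and>
     (\<forall>v\<in>R. \<forall>w\<in>R. (fst v + fst w, snd v + snd w) \<in> R) \<and>
     (\<forall>c\<in>Zp. \<forall>v\<in>R. (c \<cdot>\<^sub>v fst v, c \<cdot>\<^sub>v snd v) \<in> R)"

definition isotropic :: "nat \<Rightarrow> (('p::prime_card) padic vec \<times> 'p padic vec) set \<Rightarrow> bool" where
  "isotropic n R \<longleftrightarrow> Zp_submodule n R \<and> (\<forall>v\<in>R. \<forall>w\<in>R. skew_form v w \<in> Zp)"

definition self_dual :: "nat \<Rightarrow> (('p::prime_card) padic vec \<times> 'p padic vec) set \<Rightarrow> bool" where
  "self_dual n R \<longleftrightarrow> isotropic n R \<and> (\<forall>S. isotropic n S \<and> R \<subseteq> S \<longrightarrow> S = R)"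


section \<open>Finitary matrices and their groups\<close>

text \<open>
  A matrix with rows and columns indexed by a set \<open>I\<close> is extended to the whole index type by the
  entries of the identity matrix.  For \<open>I \<subseteq> J\<close> this makes the usual embedding
  $g \mapsto \mathrm{diag}(g, 1)$ of matrices over \<open>I\<close> into matrices over \<open>J\<close> an inclusion.
\<close>

definition fin_one :: "'i \<Rightarrow> 'i \<Rightarrow> 'a::field" where
  "fin_one r c = (if r = c then 1 else 0)"

definition fin_mats :: "'i set \<Rightarrow> ('i \<Rightarrow> 'i \<Rightarrow> 'a::field) set" where
  "fin_mats I = {g. finite {(r, c). g r c \<noteq> fin_one r c} \<and> {(r, c). g r c \<noteq> fin_one r c} \<subseteq> I \<times> I}"

definition fin_mult :: "('i \<Rightarrow> 'i \<Rightarrow> 'a::field) \<Rightarrow> ('i \<Rightarrow> 'i \<Rightarrow> 'a) \<Rightarrow> 'i \<Rightarrow> 'i \<Rightarrow> 'a" where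
  "fin_mult g h = (\<lambda>r c. Sum_any (\<lambda>s. g r s * h s c))"

definition fin_apply :: "('i \<Rightarrow> 'i \<Rightarrow> 'a::field) \<Rightarrow> ('i \<Rightarrow> 'a) \<Rightarrow> 'i \<Rightarrow> 'a" where
  "fin_apply g w = (\<lambda>r. Sum_any (\<lambda>s. g r s * w s))"

definition fin_transpose :: "('i \<Rightarrow> 'i \<Rightarrow> 'a) \<Rightarrow> 'i \<Rightarrow> 'i \<Rightarrow> 'a" where
  "fin_transpose g = (\<lambda>r c. g c r)"

definition GL_on :: "'i set \<Rightarrow> ('i \<Rightarrow> 'i \<Rightarrow> 'a::field) monoid" where
  "GL_on I = units_of \<lparr>carrier = fin_mats I, mult = fin_mult, one = fin_one\<rparr>"

text \<open>
  Index \<open>Inl a\<close> is the $a$-th coordinate of the block of size $\alpha$, index \<open>Inr (j, i)\<close> is the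
  $i$-th coordinate of the $j$-th infinite block.  All indices start from 0.
\<close>

type_synonym idx = "nat + nat \<times> nat"

definition idx_fin :: "nat \<Rightarrow> nat \<Rightarrow> nat \<Rightarrow> idx set" where
  "idx_fin \<alpha> k m = Inl ` {..<\<alpha>} \<union> Inr ` ({..<k} \<times> {..<m})"

definition idx_inf :: "nat \<Rightarrow> nat \<Rightarrow> idx set" where
  "idx_inf \<alpha> k = Inl ` {..<\<alpha>} \<union> Inr ` ({..<k} \<times> UNIV)"

definition GL_fin :: "nat \<Rightarrow> nat \<Rightarrow> nat \<Rightarrow> (idx \<Rightarrow> idx \<Rightarrow> ('p::prime_card) padic) monoid" where
  "GL_fin \<alpha> k m = GL_on (idx_fin \<alpha> k m)"

definition GL_inf :: "nat \<Rightarrow> nat \<Rightarrow> (idx \<Rightarrow> idx \<Rightarrow> ('p::prime_card) padic) monoid" where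
  "GL_inf \<alpha> k = GL_on (idx_inf \<alpha> k)"

definition O_inf :: "(nat \<Rightarrow> nat \<Rightarrow> ('p::prime_card) padic) set" where
  "O_inf = {u \<in> fin_mats UNIV. (\<forall>r c. u r c \<in> Zp) \<and>
     fin_mult u (fin_transpose u) = fin_one \<and> fin_mult (fin_transpose u) u = fin_one}"

definition diag_embed ::
    "nat \<Rightarrow> (nat \<Rightarrow> nat \<Rightarrow> ('p::prime_card) padic) \<Rightarrow> idx \<Rightarrow> idx \<Rightarrow> 'p padic" where
  "diag_embed k u r c = (case (r, c) of
       (Inr (j, i), Inr (j', i')) \<Rightarrow> if j = j' \<and> j < k then u i i' else fin_one r c
     | _ \<Rightarrow> fin_one r c)"

definition K_sub :: "nat \<Rightarrow> (idx \<Rightarrow> idx \<Rightarrow> ('p::prime_card) padic) set" where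
  "K_sub k = diag_embed k ` O_inf"

definition double_cosets :: "('g, 'b) monoid_scheme \<Rightarrow> 'g set \<Rightarrow> 'g set set" where
  "double_cosets G K = {K <#>\<^bsub>G\<^esub> {g} <#>\<^bsub>G\<^esub> K | g. g \<in> carrier G}"

text \<open>The group $\mathrm{GL}(\alpha + k\infty)$ is the union of its subgroups
  $\mathrm{GL}(\alpha + km)$.\<close>

lemma fin_mats_mono: "I \<subseteq> J \<Longrightarrow> fin_mats I \<subseteq> fin_mats J"
  unfolding fin_mats_def by blast

lemma finite_subset_idx_inf:
  assumes "finite S" and "S \<subseteq> idx_inf \<alpha> k"
  shows "\<exists>m. S \<subseteq> idx_fin \<alpha> k m"
proof -
  define f :: "idx \<Rightarrow> nat" where "f = case_sum (\<lambda>_. 0) snd"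
  have "finite (f ` S)" using assms(1) by simp
  then obtain m where "\<forall>x\<in>S. f x < m" by (auto simp: finite_nat_set_iff_bounded)
  hence "S \<subseteq> idx_fin \<alpha> k m"
    using assms(2) by (force simp: idx_fin_def idx_inf_def f_def)
  thus ?thesis ..
qed

lemma fin_mats_idx_inf:
  assumes "g \<in> fin_mats (idx_inf \<alpha> k)" "h \<in> fin_mats (idx_inf \<alpha> k)"
  shows "\<exists>m. g \<in> fin_mats (idx_fin \<alpha> k m) \<and> h \<in> fin_mats (idx_fin \<alpha> k m)"
proof -
  define D where "D = {(r, c). g r c \<noteq> fin_one r c} \<union> {(r, c). h r c \<noteq> fin_one r c}"
  have D: "finite D" "D \<subseteq> idx_inf \<alpha> k \<times> idx_inf \<alpha> k"
    using assms by (simp_all add: fin_mats_def D_def)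
  have "finite (fst ` D \<union> snd ` D)" using D(1) by simp
  moreover have "fst ` D \<union> snd ` D \<subseteq> idx_inf \<alpha> k" using D(2) by auto
  ultimately obtain m where m: "fst ` D \<union> snd ` D \<subseteq> idx_fin \<alpha> k m"
    using finite_subset_idx_inf by blast
  have "D \<subseteq> fst ` D \<times> snd ` D" by (rule subset_fst_snd)
  also have "\<dots> \<subseteq> idx_fin \<alpha> k m \<times> idx_fin \<alpha> k m" using m by (intro Sigma_mono) simp_all
  finally have "D \<subseteq> idx_fin \<alpha> k m \<times> idx_fin \<alpha> k m" .
  thus ?thesis using D(1) by (intro exI[of _ m]) (simp add: fin_mats_def D_def)
qed

lemma GL_inf_eq_Union:
  "carrier (GL_inf \<alpha> k :: (idx \<Rightarrow> idx \<Rightarrow> ('p::prime_card) padic) monoid) =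
     (\<Union>m. carrier (GL_fin \<alpha> k m))"
proof (intro equalityI subsetI)
  fix g :: "idx \<Rightarrow> idx \<Rightarrow> 'p padic"
  assume "g \<in> carrier (GL_inf \<alpha> k)"
  then obtain h where gh: "g \<in> fin_mats (idx_inf \<alpha> k)" "h \<in> fin_mats (idx_inf \<alpha> k)"
      "fin_mult h g = fin_one" "fin_mult g h = fin_one"
    by (auto simp: GL_inf_def GL_on_def units_of_def Units_def)
  from fin_mats_idx_inf[OF gh(1,2)] obtain m where
    "g \<in> fin_mats (idx_fin \<alpha> k m)" "h \<in> fin_mats (idx_fin \<alpha> k m)" by blast
  hence "g \<in> carrier (GL_fin \<alpha> k m)"
    using gh(3,4) by (auto simp: GL_fin_def GL_on_def units_of_def Units_def)
  thus "g \<in> (\<Union>m. carrier (GL_fin \<alpha> k m))" by blast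
next
  fix g :: "idx \<Rightarrow> idx \<Rightarrow> 'p padic"
  assume "g \<in> (\<Union>m. carrier (GL_fin \<alpha> k m))"
  then obtain m where "g \<in> carrier (GL_fin \<alpha> k m)" by blast
  moreover have "fin_mats (idx_fin \<alpha> k m) \<subseteq> (fin_mats (idx_inf \<alpha> k) :: (idx \<Rightarrow> idx \<Rightarrow> 'p padic) set)"
    by (rule fin_mats_mono) (auto simp: idx_fin_def idx_inf_def)
  ultimately show "g \<in> carrier (GL_inf \<alpha> k)"
    by (auto simp: GL_inf_def GL_fin_def GL_on_def units_of_def Units_def)
qed


section \<open>The characteristic function\<close>

text \<open>
  A tuple $(x_1, \dots, x_k)$ of vectors of $Q_p^m$ is the $k \times m$ matrix with rows $x_j$;
  its columns are the vectors of $i$-th coordinates.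
\<close>

definition tensor_lattice ::
    "nat \<Rightarrow> nat \<Rightarrow> (('p::prime_card) padic vec \<times> 'p padic vec) set \<Rightarrow> ('p padic mat \<times> 'p padic mat) set"
  where
  "tensor_lattice k m Q = {(xp, xm). xp \<in> carrier_mat k m \<and> xm \<in> carrier_mat k m \<and>
     (\<forall>i<m. (col xp i, col xm i) \<in> Q)}"

definition block_column :: "('a::zero) vec \<Rightarrow> 'a mat \<Rightarrow> idx \<Rightarrow> 'a" where
  "block_column u x r = (case r of
       Inl a \<Rightarrow> if a < dim_vec u then u $ a else 0
     | Inr (j, i) \<Rightarrow> if j < dim_row x \<and> i < dim_col x then x $$ (j, i) else 0)"

text \<open>
  The value $\chi_g(Q, T)$ computed for $g \in \mathrm{GL}(\alpha + km)$; an element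
  $u \oplus v$ is the pair $((u^+, u^-), (v^+, v^-))$.
\<close>

definition char_fun ::
    "nat \<Rightarrow> nat \<Rightarrow> nat \<Rightarrow> (idx \<Rightarrow> idx \<Rightarrow> ('p::prime_card) padic) \<Rightarrow>
     ('p padic vec \<times> 'p padic vec) set \<Rightarrow> ('p padic vec \<times> 'p padic vec) set \<Rightarrow>
     (('p padic vec \<times> 'p padic vec) \<times> ('p padic vec \<times> 'p padic vec)) set" where
  "char_fun \<alpha> k m g Q T =
     {((up, um), (vp, vm)) | up um vp vm.
        (up, um) \<in> double_space \<alpha> \<and> (vp, vm) \<in> double_space \<alpha> \<and>
        (\<exists>(xp, xm) \<in> tensor_lattice k m Q. \<exists>(yp, ym) \<in> tensor_lattice k m T.
           block_column vp yp = fin_apply g (block_column up xp) \<and>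
           block_column vm ym =
             fin_apply (inv\<^bsub>GL_fin \<alpha> k m\<^esub> (fin_transpose g)) (block_column um xm))}"

end

theory Submission
  imports Defs
begin

text \<open>
  Truncating a lattice element to the coordinates that \<open>g\<close> moves turns the definition of
  $\chi_g(Q, T)$ into one on finitely supported columns of unbounded length, in which the size $m$
  does not occur.  There, an element \<open>a\<close> of $O(\infty, Z_p)$ preserves the lattice of columns over
  \<open>Q\<close>, because it replaces the $i$-th coordinate vectors by $Z_p$-linear combinations of them.
  Since the inverse transpose of \<open>a\<close> is \<open>a\<close> itself, multiplying \<open>g\<close> by such elements
  on either side is absorbed by a substitution on the lattices.
\<close>

section \<open>Finitary matrices\<close>

text \<open>\<open>Sum_any\<close> has the value 0 when infinitely many summands are nonzero, so the
  rules for sums that are used below require columns of finite support.\<close>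

definition fin_support :: "('i \<Rightarrow> 'a::zero) \<Rightarrow> bool" where
  "fin_support w \<longleftrightarrow> finite {s. w s \<noteq> 0}"

text \<open>This is what a matrix must satisfy to map columns of finite support to columns of finite
  support: the unit vectors are mapped to its columns.\<close>

definition col_finite :: "('i \<Rightarrow> 'i \<Rightarrow> 'a::zero) \<Rightarrow> bool" where
  "col_finite g \<longleftrightarrow> (\<forall>c. fin_support (\<lambda>r. g r c))"

lemma fin_apply_expand:
  fixes g :: "'i \<Rightarrow> 'i \<Rightarrow> 'a::field"
  assumes "finite A" and "\<And>s. w s \<noteq> 0 \<Longrightarrow> s \<in> A"
  shows "fin_apply g w r = (\<Sum>s\<in>A. g r s * w s)"
  unfolding fin_apply_def by (rule Sum_any.expand_superset) (use assms in auto)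

text \<open>Reading a product column by column reduces statements about matrix multiplication to
  statements about the action on columns.\<close>

lemma fin_mult_eq_fin_apply: "fin_mult g h = (\<lambda>r c. fin_apply g (\<lambda>s. h s c) r)"
  by (simp add: fin_mult_def fin_apply_def)

lemma fin_support_fin_apply:
  fixes g :: "'i \<Rightarrow> 'i \<Rightarrow> 'a::field"
  assumes "col_finite g" and "fin_support w"
  shows "fin_support (fin_apply g w)"
proof -
  let ?A = "{s. w s \<noteq> 0}"
  have A: "finite ?A" using assms(2) by (simp add: fin_support_def)
  have "{r. fin_apply g w r \<noteq> 0} \<subseteq> (\<Union>s\<in>?A. {r. g r s \<noteq> 0})"
  proof
    fix r assume "r \<in> {r. fin_apply g w r \<noteq> 0}"
    hence "(\<Sum>s\<in>?A. g r s * w s) \<noteq> 0" by (simp add: fin_apply_expand[OF A])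
    then obtain s where "s \<in> ?A" "g r s * w s \<noteq> 0" by (meson sum.not_neutral_contains_not_neutral)
    thus "r \<in> (\<Union>s\<in>?A. {r. g r s \<noteq> 0})" by auto
  qed
  moreover have "finite (\<Union>s\<in>?A. {r. g r s \<noteq> 0})"
    using A assms(1) by (simp add: col_finite_def fin_support_def)
  ultimately show ?thesis unfolding fin_support_def by (rule finite_subset)
qed

text \<open>Both sides are the same double sum in two orders. Finite columns of \<open>h\<close> and
  finite support of \<open>w\<close> confine it to a finite rectangle, where the sums may be
  exchanged.\<close>

lemma fin_apply_fin_mult:
  fixes g h :: "'i \<Rightarrow> 'i \<Rightarrow> 'a::field"
  assumes h: "col_finite h" and w: "fin_support w"
  shows "fin_apply (fin_mult g h) w = fin_apply g (fin_apply h w)"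
proof
  fix r
  define A where "A = {s. w s \<noteq> 0}"
  \<comment> \<open>The union bounds the inner sums that give the entries of the product. The
    support of \<open>h w\<close> lies in it already and is adjoined so that the last step can be
    read off.\<close>
  define B where "B = (\<Union>s\<in>A. {t. h t s \<noteq> 0}) \<union> {t. fin_apply h w t \<noteq> 0}"
  have A: "finite A" "\<And>s. w s \<noteq> 0 \<Longrightarrow> s \<in> A"
    using w by (simp_all add: A_def fin_support_def)
  have B: "finite B"
    using A(1) h fin_support_fin_apply[OF h w] by (auto simp: B_def col_finite_def fin_support_def)
  have "fin_apply (fin_mult g h) w r = (\<Sum>s\<in>A. fin_mult g h r s * w s)"
    by (rule fin_apply_expand[OF A])
  also have "\<dots> = (\<Sum>s\<in>A. (\<Sum>t\<in>B. g r t * h t s) * w s)"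
    by (rule sum.cong[OF refl], subst fin_mult_eq_fin_apply, subst fin_apply_expand[OF B])
      (auto simp: B_def)
  also have "\<dots> = (\<Sum>t\<in>B. g r t * (\<Sum>s\<in>A. h t s * w s))"
    unfolding sum_distrib_left sum_distrib_right
    by (subst sum.swap) (simp add: mult.assoc)
  also have "\<dots> = (\<Sum>t\<in>B. g r t * fin_apply h w t)"
    by (simp add: fin_apply_expand[OF A])
  also have "\<dots> = fin_apply g (fin_apply h w) r"
    by (rule fin_apply_expand[OF B, symmetric]) (simp add: B_def)
  finally show "fin_apply (fin_mult g h) w r = fin_apply g (fin_apply h w) r" .
qed

text \<open>Only the summand at \<open>s = r\<close> can be nonzero, so the sum is finite for every
  \<open>w\<close>.\<close>

lemma fin_apply_id_row:
  fixes g :: "'i \<Rightarrow> 'i \<Rightarrow> 'a::field"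
  assumes "\<And>s. g r s = fin_one r s"
  shows "fin_apply g w r = w r"
proof -
  have "fin_apply g w r = (\<Sum>s\<in>{r}. g r s * w s)"
    unfolding fin_apply_def
    by (rule Sum_any.expand_superset) (auto simp: assms fin_one_def split: if_splits)
  thus ?thesis by (simp add: assms fin_one_def)
qed

lemma fin_apply_fin_one [simp]: "fin_apply fin_one w = w"
  by (rule ext, rule fin_apply_id_row) simp

lemma fin_mult_id_col:
  fixes g h :: "'i \<Rightarrow> 'i \<Rightarrow> 'a::field"
  assumes "\<And>s. h s c = fin_one s c"
  shows "fin_mult g h r c = g r c"
proof -
  have "fin_mult g h r c = (\<Sum>s\<in>{c}. g r s * h s c)"
    unfolding fin_mult_eq_fin_apply
    by (rule fin_apply_expand) (auto simp: assms fin_one_def split: if_splits)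
  thus ?thesis by (simp add: assms fin_one_def)
qed

lemma fin_transpose_fin_mult:
  "fin_transpose (fin_mult g h) = fin_mult (fin_transpose h) (fin_transpose g)"
  by (simp add: fin_transpose_def fin_mult_def mult.commute)

lemma fin_transpose_fin_transpose [simp]: "fin_transpose (fin_transpose g) = g"
  by (simp add: fin_transpose_def)

lemma fin_transpose_fin_one [simp]: "fin_transpose fin_one = fin_one"
  by (auto simp: fin_transpose_def fin_one_def fun_eq_iff)

lemma fin_transpose_fin_mats:
  assumes "g \<in> fin_mats I"
  shows "fin_transpose g \<in> fin_mats I"
proof -
  have "{(r, c). fin_transpose g r c \<noteq> fin_one r c} = {(r, c). g r c \<noteq> fin_one r c}\<inverse>"
    by (auto simp: fin_transpose_def fin_one_def)
  thus ?thesis using assms by (auto simp: fin_mats_def)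
qed

lemma fin_mats_outside:
  assumes "g \<in> fin_mats I" and "r \<notin> I \<or> c \<notin> I"
  shows "g r c = fin_one r c"
  using assms by (auto simp: fin_mats_def)

text \<open>\<open>J\<close> collects the rows and columns of all entries in which \<open>g\<close>
  or \<open>h\<close> differs from the identity. Passing from an infinite \<open>I\<close> to
  \<open>J\<close> turns the finiteness condition in \<open>fin_mats\<close> into containment in a
  finite square.\<close>

lemma fin_mats_finite_subset:
  assumes "g \<in> fin_mats I" and "h \<in> fin_mats I"
  obtains J where "finite J" "J \<subseteq> I" "g \<in> fin_mats J" "h \<in> fin_mats J"
proof
  define D where "D = {(r, c). g r c \<noteq> fin_one r c} \<union> {(r, c). h r c \<noteq> fin_one r c}"
  let ?J = "fst ` D \<union> snd ` D"
  have D: "finite D" "D \<subseteq> I \<times> I"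
    using assms by (simp_all add: fin_mats_def D_def)
  show "finite ?J" using D(1) by simp
  show "?J \<subseteq> I" using D(2) by auto
  have "D \<subseteq> ?J \<times> ?J" by force
  thus "g \<in> fin_mats ?J" "h \<in> fin_mats ?J"
    using D(1) by (simp_all add: fin_mats_def D_def)
qed

text \<open>A nonzero entry of column \<open>c\<close> is the diagonal one or one of the finitely
  many deviations from the identity.\<close>

lemma col_finite_fin_mats:
  assumes "g \<in> fin_mats I"
  shows "col_finite g"
  unfolding col_finite_def fin_support_def
proof
  fix c
  have "{r. g r c \<noteq> 0} \<subseteq> insert c (fst ` {(r, c). g r c \<noteq> fin_one r c})"
  proof
    fix r assume "r \<in> {r. g r c \<noteq> 0}"
    hence "r = c \<or> (r, c) \<in> {(r, c). g r c \<noteq> fin_one r c}" by (auto simp: fin_one_def)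
    thus "r \<in> insert c (fst ` {(r, c). g r c \<noteq> fin_one r c})" by (auto intro: rev_image_eqI)
  qed
  moreover have "finite (insert c (fst ` {(r, c). g r c \<noteq> fin_one r c}))"
    using assms by (simp add: fin_mats_def)
  ultimately show "finite {r. g r c \<noteq> 0}" by (rule finite_subset)
qed

section \<open>The monoid of finitary matrices and its group of units\<close>

lemma fin_mult_closed:
  fixes g h :: "'i \<Rightarrow> 'i \<Rightarrow> 'a::field"
  assumes "g \<in> fin_mats I" and "h \<in> fin_mats I"
  shows "fin_mult g h \<in> fin_mats I"
proof -
  obtain J where J: "finite J" "J \<subseteq> I" "g \<in> fin_mats J" "h \<in> fin_mats J"
    using assms by (rule fin_mats_finite_subset)
  \<comment> \<open>Outside \<open>J\<close> both factors have rows and columns of the identity: a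
    row of the product is then the row of \<open>h\<close>, a column is the column of
    \<open>g\<close>.\<close>
  have "fin_mult g h r c = fin_one r c" if "r \<notin> J \<or> c \<notin> J" for r c
  proof (cases "r \<in> J")
    case False
    hence "fin_mult g h r c = h r c"
      unfolding fin_mult_eq_fin_apply
      by (intro fin_apply_id_row) (simp add: fin_mats_outside[OF J(3)])
    thus ?thesis using False by (simp add: fin_mats_outside[OF J(4)])
  next
    case True
    hence c: "c \<notin> J" using that by simp
    hence "fin_mult g h r c = g r c"
      by (intro fin_mult_id_col) (simp add: fin_mats_outside[OF J(4)])
    thus ?thesis using c by (simp add: fin_mats_outside[OF J(3)])
  qed
  hence "{(r, c). fin_mult g h r c \<noteq> fin_one r c} \<subseteq> J \<times> J" by auto
  hence "fin_mult g h \<in> fin_mats J"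
    using J(1) by (auto simp: fin_mats_def intro: finite_subset)
  thus ?thesis using fin_mats_mono[OF J(2)] by blast
qed

lemma fin_mult_assoc:
  fixes g h l :: "'i \<Rightarrow> 'i \<Rightarrow> 'a::field"
  assumes "col_finite h" and "col_finite l"
  shows "fin_mult (fin_mult g h) l = fin_mult g (fin_mult h l)"
proof (intro ext)
  fix r c
  have "fin_support (\<lambda>s. l s c)" using assms(2) by (simp add: col_finite_def)
  from fin_apply_fin_mult[OF assms(1) this]
  show "fin_mult (fin_mult g h) l r c = fin_mult g (fin_mult h l) r c"
    by (simp add: fin_mult_eq_fin_apply[of _ l] fin_mult_eq_fin_apply[of g "\<lambda>r c. fin_apply h (\<lambda>s. l s c) r"])
qed

lemma monoid_fin_mats:
  "monoid \<lparr>carrier = fin_mats I, mult = fin_mult, one = (fin_one :: 'i \<Rightarrow> 'i \<Rightarrow> 'a::field)\<rparr>"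
proof (rule monoidI, simp_all)
  show "fin_one \<in> fin_mats I" by (simp add: fin_mats_def)
  show "fin_mult g h \<in> fin_mats I" if "g \<in> fin_mats I" "h \<in> fin_mats I"
    for g h :: "'i \<Rightarrow> 'i \<Rightarrow> 'a"
    using that by (rule fin_mult_closed)
  show "fin_mult (fin_mult g h) l = fin_mult g (fin_mult h l)"
    if "g \<in> fin_mats I" "h \<in> fin_mats I" "l \<in> fin_mats I" for g h l :: "'i \<Rightarrow> 'i \<Rightarrow> 'a"
    using that by (intro fin_mult_assoc col_finite_fin_mats)
  show "fin_mult fin_one g = g" for g :: "'i \<Rightarrow> 'i \<Rightarrow> 'a"
    by (simp add: fin_mult_eq_fin_apply)
  show "fin_mult g fin_one = g" for g :: "'i \<Rightarrow> 'i \<Rightarrow> 'a"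
    by (intro ext fin_mult_id_col) simp
qed

lemma group_GL_on: "group (GL_on I)"
  unfolding GL_on_def by (intro monoid.units_group monoid_fin_mats)

lemma carrier_GL_on:
  "g \<in> carrier (GL_on I) \<longleftrightarrow>
     g \<in> fin_mats I \<and> (\<exists>h\<in>fin_mats I. fin_mult h g = fin_one \<and> fin_mult g h = fin_one)"
  by (auto simp: GL_on_def units_of_def Units_def)

text \<open>Transposition reverses products, so it interchanges the two equations for a two-sided
  inverse and yields the transposed inverse.\<close>

lemma fin_transpose_GL_on:
  assumes "g \<in> carrier (GL_on I)"
  shows "fin_transpose g \<in> carrier (GL_on I)"
  using assms unfolding carrier_GL_on
  by (metis fin_transpose_fin_mats fin_transpose_fin_mult fin_transpose_fin_one)

text \<open>This removes the group inverse from the equation for the minus components. The supports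
  of \<open>w\<close> and \<open>z\<close> are finite so that the products of the matrix with its
  inverse may be cancelled on these columns.\<close>

lemma fin_apply_inv_GL_on:
  assumes g: "g \<in> carrier (GL_on I)" and w: "fin_support w" and z: "fin_support z"
  shows "z = fin_apply (inv\<^bsub>GL_on I\<^esub> g) w \<longleftrightarrow> w = fin_apply g z"
proof -
  interpret group "GL_on I" by (rule group_GL_on)
  let ?h = "inv\<^bsub>GL_on I\<^esub> g"
  have h: "?h \<in> carrier (GL_on I)" using g by (rule inv_closed)
  have "fin_mult ?h g = fin_one" "fin_mult g ?h = fin_one"
    using l_inv[OF g] r_inv[OF g] by (simp_all add: GL_on_def units_of_def)
  moreover have "col_finite g" "col_finite ?h"
    using g h by (auto simp: carrier_GL_on intro: col_finite_fin_mats)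
  ultimately show ?thesis
    using fin_apply_fin_mult w z by (metis fin_apply_fin_one)
qed

section \<open>The action of the orthogonal group\<close>

lemma diag_embed_fin_transpose:
  "diag_embed k (fin_transpose u) = fin_transpose (diag_embed k u)"
  by (auto simp: diag_embed_def fin_transpose_def fin_one_def fun_eq_iff split: sum.splits)

lemma O_inf_fin_transpose: "u \<in> O_inf \<Longrightarrow> fin_transpose u \<in> O_inf"
  using fin_transpose_fin_mats by (fastforce simp: O_inf_def fin_transpose_def)

text \<open>The deviations from the identity are \<open>k\<close> copies of the finitely many
  deviations of \<open>u\<close>.\<close>

lemma diag_embed_fin_mats:
  assumes "u \<in> fin_mats UNIV"
  shows "diag_embed k u \<in> fin_mats UNIV"
proof -
  let ?D = "{(r, c). u r c \<noteq> fin_one r c}"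
  have "{(r, c). diag_embed k u r c \<noteq> fin_one r c}
      \<subseteq> (\<lambda>(j, i, i'). (Inr (j, i), Inr (j, i'))) ` ({..<k} \<times> ?D)"
    by (force simp: diag_embed_def fin_one_def image_iff split: sum.splits if_splits)
  moreover have "finite ({..<k} \<times> ?D)" using assms by (simp add: fin_mats_def)
  ultimately show ?thesis
    unfolding fin_mats_def using finite_surj by auto
qed

lemmas col_finite_diag_embed = diag_embed_fin_mats[THEN col_finite_fin_mats]

text \<open>The matrix is block diagonal, so the sum for a row in block \<open>j\<close> involves
  only the entries of \<open>w\<close> in that block.\<close>

lemma fin_apply_diag_embed:
  assumes w: "fin_support w"
  shows "fin_apply (diag_embed k u) w r = (case r of
      Inl a \<Rightarrow> w r
    | Inr (j, i) \<Rightarrow> if j < k then fin_apply u (\<lambda>s. w (Inr (j, s))) i else w r)"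
proof (cases "\<exists>j i. r = Inr (j, i) \<and> j < k")
  case False
  have "fin_apply (diag_embed k u) w r = w r"
    by (rule fin_apply_id_row) (use False in \<open>auto simp: diag_embed_def split: sum.splits\<close>)
  thus ?thesis using False by (auto split: sum.splits)
next
  case True
  then obtain j i where r: "r = Inr (j, i)" "j < k" by blast
  define A where "A = {s. w s \<noteq> 0}"
  define B where "B = {s. w (Inr (j, s)) \<noteq> 0}"
  have A: "finite A" using w by (simp add: A_def fin_support_def)
  have inj: "inj_on (\<lambda>s. Inr (j, s) :: idx) B" by (auto simp: inj_on_def)
  have sub: "(\<lambda>s. Inr (j, s) :: idx) ` B \<subseteq> A" by (auto simp: A_def B_def)
  have B: "finite B" using inj A sub by (meson finite_imageD finite_subset)
  have "fin_apply (diag_embed k u) w r = (\<Sum>s\<in>A. diag_embed k u r s * w s)"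
    by (rule fin_apply_expand[OF A]) (simp add: A_def)
  \<comment> \<open>Indices of \<open>A\<close> outside block \<open>j\<close> drop out because row
    \<open>r\<close> vanishes there.\<close>
  also have "\<dots> = (\<Sum>s\<in>(\<lambda>s. Inr (j, s)) ` B. diag_embed k u r s * w s)"
    by (rule sum.mono_neutral_right[OF A sub])
      (auto simp: A_def B_def r diag_embed_def fin_one_def split: sum.splits)
  also have "\<dots> = (\<Sum>s\<in>B. u i s * w (Inr (j, s)))"
    by (subst sum.reindex[OF inj]) (simp add: r diag_embed_def)
  also have "\<dots> = fin_apply u (\<lambda>s. w (Inr (j, s))) i"
    by (rule fin_apply_expand[OF B, symmetric]) (simp add: B_def)
  finally show ?thesis by (simp add: r)
qed

lemma fin_support_block:
  assumes "fin_support w"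
  shows "fin_support (\<lambda>s. w (Inr (j, s)))"
  using finite_vimageI[of "{s. w s \<noteq> 0}" "\<lambda>s. Inr (j, s)"] assms
  by (auto simp: fin_support_def vimage_def inj_def)

text \<open>Each of the \<open>k\<close> blocks is acted on by \<open>u\<close> and then by its
  transpose, which cancel; all other coordinates stay fixed.\<close>

lemma fin_apply_diag_embed_orthogonal:
  assumes u: "u \<in> O_inf" and w: "fin_support w"
  shows "fin_apply (fin_transpose (diag_embed k u)) (fin_apply (diag_embed k u) w) = w"
proof
  fix r
  have fm: "u \<in> fin_mats UNIV" "fin_mult (fin_transpose u) u = fin_one"
    using u by (simp_all add: O_inf_def)
  have "fin_apply (fin_transpose u) (fin_apply u (\<lambda>s. w (Inr (j, s)))) = (\<lambda>s. w (Inr (j, s)))"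
    for j
    using fin_apply_fin_mult[OF col_finite_fin_mats[OF fm(1)] fin_support_block[OF w], of "fin_transpose u"]
    by (simp add: fm(2))
  moreover have "fin_support (fin_apply (diag_embed k u) w)"
    by (intro fin_support_fin_apply col_finite_diag_embed fm w)
  ultimately show "fin_apply (fin_transpose (diag_embed k u)) (fin_apply (diag_embed k u) w) r = w r"
    unfolding diag_embed_fin_transpose[symmetric]
    by (simp add: fin_apply_diag_embed w split: sum.split)
qed

text \<open>Column \<open>c\<close> of a matrix is its value on the unit vector at \<open>c\<close>,
  to which the cancellation on columns applies.\<close>

lemma diag_embed_orthogonal:
  assumes "u \<in> O_inf"
  shows "fin_mult (fin_transpose (diag_embed k u)) (diag_embed k u) = fin_one"
proof -
  let ?u = "diag_embed k u"
  have "u \<in> fin_mats UNIV" using assms by (simp add: O_inf_def)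
  hence "col_finite ?u" by (rule col_finite_diag_embed)
  have "fin_mult (fin_transpose ?u) ?u r c = fin_one r c" for r c
  proof -
    have e: "fin_support (\<lambda>s. fin_one s c :: 'a padic)"
      by (simp add: fin_support_def fin_one_def)
    have "(\<lambda>s. ?u s c) = fin_apply ?u (\<lambda>s. fin_one s c)"
      using fin_mult_id_col[of fin_one c ?u] by (simp add: fin_mult_eq_fin_apply fun_eq_iff)
    thus ?thesis
      using fin_apply_diag_embed_orthogonal[OF assms e, of k] by (simp add: fin_mult_eq_fin_apply)
  qed
  thus ?thesis by blast
qed

section \<open>Lattices of finitely supported columns\<close>

definition slice :: "nat \<Rightarrow> (idx \<Rightarrow> 'a) \<Rightarrow> nat \<Rightarrow> 'a vec" where
  "slice k w i = vec k (\<lambda>j. w (Inr (j, i)))"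

definition head_part :: "nat \<Rightarrow> (idx \<Rightarrow> 'a) \<Rightarrow> 'a vec" where
  "head_part \<alpha> w = vec \<alpha> (\<lambda>a. w (Inl a))"

text \<open>For a submodule \<open>Q\<close> this is the union over \<open>m\<close> of the pairs of
  columns with arbitrary heads and with tails in the tensor product of \<open>Q\<close> with
  \<open>Z_p^m\<close>, each padded by zeros.\<close>

definition column_lattice ::
    "nat \<Rightarrow> nat \<Rightarrow> (('p::prime_card) padic vec \<times> 'p padic vec) set
      \<Rightarrow> ((idx \<Rightarrow> 'p padic) \<times> (idx \<Rightarrow> 'p padic)) set" where
  "column_lattice \<alpha> k Q = {(wp, wm). fin_support wp \<and> fin_support wm \<and>
     (\<forall>r. r \<notin> idx_inf \<alpha> k \<longrightarrow> wp r = 0 \<and> wm r = 0) \<and>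
     (\<forall>i. (slice k wp i, slice k wm i) \<in> Q)}"

text \<open>Closure under addition and scaling, by induction on \<open>A\<close>. The coordinatewise
  form matches the slices of a transformed column, with the same coefficients in both
  components.\<close>

lemma Zp_submodule_sum:
  assumes Q: "Zp_submodule n Q" and "finite A" and c: "\<And>s. c s \<in> Zp"
    and x: "\<And>s. (vec n (x s), vec n (y s)) \<in> Q"
  shows "(vec n (\<lambda>j. \<Sum>s\<in>A. c s * x s j), vec n (\<lambda>j. \<Sum>s\<in>A. c s * y s j)) \<in> Q"
  using \<open>finite A\<close>
proof (induction A)
  case empty
  show ?case using Q by (simp add: Zp_submodule_def zero_vec_def)
next
  case (insert s A)
  have "(c s \<cdot>\<^sub>v vec n (x s), c s \<cdot>\<^sub>v vec n (y s)) \<in> Q"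
    using Q c x unfolding Zp_submodule_def by force
  with insert.IH have
    "(c s \<cdot>\<^sub>v vec n (x s) + vec n (\<lambda>j. \<Sum>s\<in>A. c s * x s j),
      c s \<cdot>\<^sub>v vec n (y s) + vec n (\<lambda>j. \<Sum>s\<in>A. c s * y s j)) \<in> Q"
    using Q unfolding Zp_submodule_def by force
  moreover have "c s \<cdot>\<^sub>v vec n (z s) + vec n (\<lambda>j. \<Sum>s\<in>A. c s * z s j)
      = vec n (\<lambda>j. \<Sum>s\<in>insert s A. c s * z s j)" for z
    using insert.hyps by (intro eq_vecI) auto
  ultimately show ?case by simp
qed

text \<open>Since the same \<open>u\<close> acts in every block, slice \<open>i\<close> of the image
  is the combination of the slices \<open>s\<close> with coefficients \<open>u i s\<close>. These
  lie in \<open>Zp\<close>, so the combination stays in \<open>Q\<close>.\<close>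

lemma diag_embed_column_lattice:
  assumes Q: "Zp_submodule k Q" and u: "u \<in> O_inf" and w: "(wp, wm) \<in> column_lattice \<alpha> k Q"
  shows "(fin_apply (diag_embed k u) wp, fin_apply (diag_embed k u) wm) \<in> column_lattice \<alpha> k Q"
proof -
  have fs: "fin_support wp" "fin_support wm" using w by (auto simp: column_lattice_def)
  have zero: "wp r = 0 \<and> wm r = 0" if "r \<notin> idx_inf \<alpha> k" for r
    using w that by (auto simp: column_lattice_def)
  have um: "u \<in> fin_mats UNIV" "\<And>r c. u r c \<in> Zp" using u by (auto simp: O_inf_def)
  have "(slice k (fin_apply (diag_embed k u) wp) i, slice k (fin_apply (diag_embed k u) wm) i) \<in> Q"
    for i
  proof -
    \<comment> \<open>One finite set of positions that serves all \<open>k\<close> blocks and both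
      signs, so that the coordinate sums assemble into a sum of vectors.\<close>
    define A where "A = (\<Union>j<k. {s. wp (Inr (j, s)) \<noteq> 0} \<union> {s. wm (Inr (j, s)) \<noteq> 0})"
    have A: "finite A"
      using fs[THEN fin_support_block] by (simp add: A_def fin_support_def)
    have "slice k (fin_apply (diag_embed k u) w) i = vec k (\<lambda>j. \<Sum>s\<in>A. u i s * w (Inr (j, s)))"
      if "w = wp \<or> w = wm" for w
      unfolding slice_def
    proof (intro eq_vecI, simp_all)
      fix j assume "j < k"
      have "fin_support w" using that fs by auto
      hence "fin_apply (diag_embed k u) w (Inr (j, i)) = fin_apply u (\<lambda>s. w (Inr (j, s))) i"
        using \<open>j < k\<close> by (simp add: fin_apply_diag_embed)
      also have "\<dots> = (\<Sum>s\<in>A. u i s * w (Inr (j, s)))"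
        by (rule fin_apply_expand[OF A]) (use that \<open>j < k\<close> in \<open>auto simp: A_def\<close>)
      finally show "fin_apply (diag_embed k u) w (Inr (j, i)) = (\<Sum>s\<in>A. u i s * w (Inr (j, s)))" .
    qed
    moreover have "(vec k (\<lambda>j. wp (Inr (j, s))), vec k (\<lambda>j. wm (Inr (j, s)))) \<in> Q" for s
      using w by (auto simp: column_lattice_def slice_def)
    ultimately show ?thesis
      using Zp_submodule_sum[OF Q A, of "\<lambda>s. u i s"] um(2) by simp
  qed
  moreover have "fin_support (fin_apply (diag_embed k u) w)" if "fin_support w" for w
    by (intro fin_support_fin_apply col_finite_diag_embed um that)
  moreover have "fin_apply (diag_embed k u) wp r = 0 \<and> fin_apply (diag_embed k u) wm r = 0"
    if "r \<notin> idx_inf \<alpha> k" for r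
  proof -
    have "\<not> (\<exists>j i. r = Inr (j, i) \<and> j < k)" using that by (auto simp: idx_inf_def)
    thus ?thesis using zero[OF that] by (auto simp: fin_apply_diag_embed fs split: sum.splits)
  qed
  ultimately show ?thesis using fs by (auto simp: column_lattice_def)
qed

lemma head_part_diag_embed [simp]:
  "fin_support w \<Longrightarrow> head_part \<alpha> (fin_apply (diag_embed k u) w) = head_part \<alpha> w"
  by (auto simp: head_part_def fin_apply_diag_embed)

section \<open>The characteristic function without a size parameter\<close>

text \<open>
  The second equation is stated for the transpose of \<open>g\<close> instead of its inverse, with the two sides
  exchanged, so that no inverse occurs.
\<close>

definition char_fun_inf ::
    "nat \<Rightarrow> nat \<Rightarrow> (idx \<Rightarrow> idx \<Rightarrow> ('p::prime_card) padic) \<Rightarrow>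
     ('p padic vec \<times> 'p padic vec) set \<Rightarrow> ('p padic vec \<times> 'p padic vec) set \<Rightarrow>
     (('p padic vec \<times> 'p padic vec) \<times> ('p padic vec \<times> 'p padic vec)) set" where
  "char_fun_inf \<alpha> k g Q T =
     {((head_part \<alpha> wp, head_part \<alpha> wm), (head_part \<alpha> zp, head_part \<alpha> zm)) | wp wm zp zm.
        (wp, wm) \<in> column_lattice \<alpha> k Q \<and> (zp, zm) \<in> column_lattice \<alpha> k T \<and>
        zp = fin_apply g wp \<and> wm = fin_apply (fin_transpose g) zm}"

lemma char_fun_infI:
  assumes "(wp, wm) \<in> column_lattice \<alpha> k Q" and "(zp, zm) \<in> column_lattice \<alpha> k T"
    and "zp = fin_apply g wp" and "wm = fin_apply (fin_transpose g) zm"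
  shows "((head_part \<alpha> wp, head_part \<alpha> wm), (head_part \<alpha> zp, head_part \<alpha> zm))
    \<in> char_fun_inf \<alpha> k g Q T"
  unfolding char_fun_inf_def using assms by blast

section \<open>Comparison with the definition at a fixed size\<close>

lemma block_column_column_lattice:
  assumes "Zp_submodule k Q" and "dim_vec hp = \<alpha>" and "dim_vec hm = \<alpha>"
    and "(xp, xm) \<in> tensor_lattice k m Q"
  shows "(block_column hp xp, block_column hm xm) \<in> column_lattice \<alpha> k Q"
proof -
  have x: "xp \<in> carrier_mat k m" "xm \<in> carrier_mat k m"
    "\<And>i. i < m \<Longrightarrow> (col xp i, col xm i) \<in> Q"
    using assms(4) by (auto simp: tensor_lattice_def)
  have zero: "block_column v y r = 0" if "r \<notin> idx_fin \<alpha> k m" "dim_vec v = \<alpha>" "y \<in> carrier_mat k m"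
    for v :: "'a padic vec" and y r
    using that by (auto simp: block_column_def idx_fin_def split: sum.splits)
  have fin: "finite (idx_fin \<alpha> k m)" by (simp add: idx_fin_def)
  have "fin_support (block_column v y)" if "dim_vec v = \<alpha>" "y \<in> carrier_mat k m"
    for v :: "'a padic vec" and y
    unfolding fin_support_def by (rule finite_subset[OF _ fin]) (use zero that in blast)
  moreover have "idx_fin \<alpha> k m \<subseteq> idx_inf \<alpha> k" by (auto simp: idx_fin_def idx_inf_def)
  moreover have "(slice k (block_column hp xp) i, slice k (block_column hm xm) i) \<in> Q" for i
  proof (cases "i < m")
    case True
    hence "slice k (block_column v y) i = col y i" if "y \<in> carrier_mat k m"
      for v :: "'a padic vec" and y
      using that by (intro eq_vecI) (auto simp: slice_def block_column_def)
    thus ?thesis using x True by simp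
  next
    \<comment> \<open>Beyond the first \<open>m\<close> coordinates the padding gives the zero
      vector, which every submodule contains.\<close>
    case False
    hence "slice k (block_column v y) i = 0\<^sub>v k" if "y \<in> carrier_mat k m"
      for v :: "'a padic vec" and y
      using that by (intro eq_vecI) (auto simp: slice_def block_column_def)
    thus ?thesis using x assms(1) by (simp add: Zp_submodule_def)
  qed
  ultimately show ?thesis
    using x(1,2) zero assms(2,3) unfolding column_lattice_def by (simp add: subset_iff) blast
qed

definition truncate_to :: "'i set \<Rightarrow> ('i \<Rightarrow> 'a::zero) \<Rightarrow> 'i \<Rightarrow> 'a" where
  "truncate_to I w = (\<lambda>r. if r \<in> I then w r else 0)"

text \<open>Such a \<open>g\<close> is block diagonal for the splitting into \<open>I\<close> and
  its complement, being the identity on the latter, so it commutes with the projection to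
  \<open>I\<close>.\<close>

lemma fin_apply_truncate_to:
  fixes g :: "'i \<Rightarrow> 'i \<Rightarrow> 'a::field"
  assumes g: "g \<in> fin_mats I"
  shows "fin_apply g (truncate_to I w) = truncate_to I (fin_apply g w)"
proof
  fix r
  show "fin_apply g (truncate_to I w) r = truncate_to I (fin_apply g w) r"
  proof (cases "r \<in> I")
    case True
    have "g r s * truncate_to I w s = g r s * w s" for s
      using True fin_mats_outside[OF g, of r s] by (auto simp: truncate_to_def fin_one_def)
    hence "fin_apply g (truncate_to I w) r = fin_apply g w r" by (simp only: fin_apply_def)
    thus ?thesis using True by (simp add: truncate_to_def[of I "fin_apply g w"])
  next
    case False
    hence "fin_apply g (truncate_to I w) r = truncate_to I w r"
      by (intro fin_apply_id_row) (simp add: fin_mats_outside[OF g])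
    thus ?thesis using False by (simp add: truncate_to_def)
  qed
qed

lemma truncate_column_lattice:
  assumes "(wp, wm) \<in> column_lattice \<alpha> k Q"
  obtains xp xm where "(xp, xm) \<in> tensor_lattice k m Q"
    "block_column (head_part \<alpha> wp) xp = truncate_to (idx_fin \<alpha> k m) wp"
    "block_column (head_part \<alpha> wm) xm = truncate_to (idx_fin \<alpha> k m) wm"
proof
  let ?x = "\<lambda>w. mat k m (\<lambda>(j, i). w (Inr (j, i)))"
  have "col (?x w) i = slice k w i" if "i < m" for w :: "idx \<Rightarrow> 'a padic" and i
    using that by (intro eq_vecI) (auto simp: slice_def)
  thus "(?x wp, ?x wm) \<in> tensor_lattice k m Q"
    using assms by (auto simp: tensor_lattice_def column_lattice_def)
  have "block_column (head_part \<alpha> w) (?x w) = truncate_to (idx_fin \<alpha> k m) w"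
    for w :: "idx \<Rightarrow> 'a padic"
    by (rule ext)
      (auto simp: block_column_def head_part_def truncate_to_def idx_fin_def split: sum.splits)
  thus "block_column (head_part \<alpha> wp) (?x wp) = truncate_to (idx_fin \<alpha> k m) wp"
    "block_column (head_part \<alpha> wm) (?x wm) = truncate_to (idx_fin \<alpha> k m) wm" by blast+
qed

text \<open>Padding by zeros gives one inclusion and truncation the other. Both preserve heads,
  lattice conditions and the two equations.\<close>

lemma char_fun_eq_char_fun_inf:
  assumes g: "g \<in> carrier (GL_fin \<alpha> k m)" and Q: "Zp_submodule k Q" and T: "Zp_submodule k T"
  shows "char_fun \<alpha> k m g Q T = char_fun_inf \<alpha> k g Q T"
proof (intro equalityI subsetI)
  let ?I = "idx_fin \<alpha> k m"
  have gt: "fin_transpose g \<in> carrier (GL_on ?I)"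
    using g by (auto simp: GL_fin_def intro: fin_transpose_GL_on)
  have inv_iff: "z = fin_apply (inv\<^bsub>GL_fin \<alpha> k m\<^esub> (fin_transpose g)) w
      \<longleftrightarrow> w = fin_apply (fin_transpose g) z" if "fin_support w" "fin_support z" for w z
    unfolding GL_fin_def using gt that by (rule fin_apply_inv_GL_on)
  {
    fix e assume "e \<in> char_fun \<alpha> k m g Q T"
    then obtain hp hm vp vm xp xm yp ym where e: "e = ((hp, hm), (vp, vm))"
      and dims: "dim_vec hp = \<alpha>" "dim_vec hm = \<alpha>" "dim_vec vp = \<alpha>" "dim_vec vm = \<alpha>"
      and xy: "(xp, xm) \<in> tensor_lattice k m Q" "(yp, ym) \<in> tensor_lattice k m T"
      and p: "block_column vp yp = fin_apply g (block_column hp xp)"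
      and m: "block_column vm ym =
        fin_apply (inv\<^bsub>GL_fin \<alpha> k m\<^esub> (fin_transpose g)) (block_column hm xm)"
      unfolding char_fun_def double_space_def by fastforce
    have L: "(block_column hp xp, block_column hm xm) \<in> column_lattice \<alpha> k Q"
      "(block_column vp yp, block_column vm ym) \<in> column_lattice \<alpha> k T"
      using block_column_column_lattice Q T dims xy by blast+
    hence "block_column hm xm = fin_apply (fin_transpose g) (block_column vm ym)"
      using m by (subst (asm) inv_iff) (auto simp: column_lattice_def)
    moreover have "head_part \<alpha> (block_column v x) = v" if "dim_vec v = \<alpha>"
      for v :: "'a padic vec" and x
      using that by (intro eq_vecI) (auto simp: head_part_def block_column_def)
    ultimately show "e \<in> char_fun_inf \<alpha> k g Q T"
      using char_fun_infI[OF L p] unfolding e by (metis dims)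
  next
    fix e assume "e \<in> char_fun_inf \<alpha> k g Q T"
    then obtain wp wm zp zm where
      e: "e = ((head_part \<alpha> wp, head_part \<alpha> wm), (head_part \<alpha> zp, head_part \<alpha> zm))"
      and w: "(wp, wm) \<in> column_lattice \<alpha> k Q" and z: "(zp, zm) \<in> column_lattice \<alpha> k T"
      and p: "zp = fin_apply g wp" and m: "wm = fin_apply (fin_transpose g) zm"
      unfolding char_fun_inf_def by blast
    \<comment> \<open>The columns may extend beyond the first \<open>m\<close> coordinates of a
      block; they are cut off there, where \<open>g\<close> is the identity.\<close>
    obtain xp xm where x: "(xp, xm) \<in> tensor_lattice k m Q"
      "block_column (head_part \<alpha> wp) xp = truncate_to ?I wp"
      "block_column (head_part \<alpha> wm) xm = truncate_to ?I wm"
      using w by (rule truncate_column_lattice)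
    obtain yp ym where y: "(yp, ym) \<in> tensor_lattice k m T"
      "block_column (head_part \<alpha> zp) yp = truncate_to ?I zp"
      "block_column (head_part \<alpha> zm) ym = truncate_to ?I zm"
      using z by (rule truncate_column_lattice)
    have "g \<in> fin_mats ?I" "fin_transpose g \<in> fin_mats ?I"
      using g gt by (simp_all add: GL_fin_def carrier_GL_on)
    note tr = this[THEN fin_apply_truncate_to]
    have fs: "fin_support (truncate_to ?I v)" for v :: "idx \<Rightarrow> 'a padic"
      unfolding fin_support_def
      by (rule finite_subset[of _ ?I]) (auto simp: truncate_to_def idx_fin_def)
    \<comment> \<open>After clearing the inverse this is the truncation of the equation for
      \<open>wm\<close>, since the transpose of \<open>g\<close> commutes with truncation.\<close>
    have "truncate_to ?I zm = fin_apply (inv\<^bsub>GL_fin \<alpha> k m\<^esub> (fin_transpose g)) (truncate_to ?I wm)"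
      using fs by (simp add: inv_iff tr m)
    moreover have "truncate_to ?I zp = fin_apply g (truncate_to ?I wp)" by (simp add: tr p)
    moreover have "head_part \<alpha> v \<in> carrier_vec \<alpha>" for v :: "idx \<Rightarrow> 'a padic"
      by (simp add: head_part_def)
    ultimately show "e \<in> char_fun \<alpha> k m g Q T"
      unfolding char_fun_def double_space_def e
      by (auto intro!: bexI[OF _ x(1)] bexI[OF _ y(1)] simp: x y)
  }
qed

text \<open>A solution for the product becomes one for \<open>g\<close> when \<open>b\<close> is
  applied to both \<open>wp\<close>, \<open>wm\<close> and the transpose of \<open>a\<close> to both
  \<open>zp\<close>, \<open>zm\<close>. The same matrix serves both signs because \<open>a\<close>
  and \<open>b\<close> are their own inverse transposes; lattices and heads are preserved.\<close>

lemma char_fun_inf_mult_subset: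
  assumes a: "a \<in> O_inf" and b: "b \<in> O_inf" and g: "g \<in> fin_mats I"
    and Q: "Zp_submodule k Q" and T: "Zp_submodule k T"
  shows "char_fun_inf \<alpha> k (fin_mult (fin_mult (diag_embed k a) g) (diag_embed k b)) Q T
    \<subseteq> char_fun_inf \<alpha> k g Q T"
proof
  let ?a = "diag_embed k a" and ?b = "diag_embed k b"
  let ?at = "diag_embed k (fin_transpose a)" and ?bt = "diag_embed k (fin_transpose b)"
  fix e assume "e \<in> char_fun_inf \<alpha> k (fin_mult (fin_mult ?a g) ?b) Q T"
  then obtain wp wm zp zm where
    e: "e = ((head_part \<alpha> wp, head_part \<alpha> wm), (head_part \<alpha> zp, head_part \<alpha> zm))"
    and w: "(wp, wm) \<in> column_lattice \<alpha> k Q" and z: "(zp, zm) \<in> column_lattice \<alpha> k T"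
    and p: "zp = fin_apply (fin_mult (fin_mult ?a g) ?b) wp"
    and m: "wm = fin_apply (fin_transpose (fin_mult (fin_mult ?a g) ?b)) zm"
    unfolding char_fun_inf_def by blast
  have fs: "fin_support wp" "fin_support wm" "fin_support zp" "fin_support zm"
    using w z by (auto simp: column_lattice_def)
  have cf: "col_finite ?a" "col_finite ?b" "col_finite ?at" "col_finite ?bt"
    "col_finite g" "col_finite (fin_transpose g)"
    using a b g O_inf_fin_transpose[OF a] O_inf_fin_transpose[OF b]
    by (auto simp: O_inf_def
        intro: col_finite_diag_embed col_finite_fin_mats fin_transpose_fin_mats)
  have zp: "zp = fin_apply ?a (fin_apply g (fin_apply ?b wp))"
    using p by (simp add: fin_apply_fin_mult fin_support_fin_apply cf fs)
  \<comment> \<open>Transposition reverses the three factors. The product of the transposes of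
    \<open>g\<close> and \<open>?a\<close> has finite columns because each is the image of a
    finitely supported one.\<close>
  have wm: "wm = fin_apply ?bt (fin_apply (fin_transpose g) (fin_apply ?at zm))"
    unfolding m fin_transpose_fin_mult diag_embed_fin_transpose[symmetric]
    by (subst fin_apply_fin_mult; (subst fin_apply_fin_mult)?)
      (simp_all add: fin_mult_eq_fin_apply col_finite_def fin_support_fin_apply cf[unfolded col_finite_def] cf fs)
  have "fin_apply ?at zp = fin_apply g (fin_apply ?b wp)"
    unfolding zp diag_embed_fin_transpose
    by (intro fin_apply_diag_embed_orthogonal fin_support_fin_apply a cf fs)
  moreover have "fin_apply ?b wm = fin_apply (fin_transpose g) (fin_apply ?at zm)"
    unfolding wm using fin_apply_diag_embed_orthogonal[OF O_inf_fin_transpose[OF b],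
        of "fin_apply (fin_transpose g) (fin_apply ?at zm)" k]
    by (simp add: diag_embed_fin_transpose[symmetric] fin_support_fin_apply cf fs)
  ultimately have "((head_part \<alpha> (fin_apply ?b wp), head_part \<alpha> (fin_apply ?b wm)),
      (head_part \<alpha> (fin_apply ?at zp), head_part \<alpha> (fin_apply ?at zm))) \<in> char_fun_inf \<alpha> k g Q T"
    using diag_embed_column_lattice[OF Q b w]
      diag_embed_column_lattice[OF T O_inf_fin_transpose[OF a] z]
    by (intro char_fun_infI)
  thus "e \<in> char_fun_inf \<alpha> k g Q T" by (simp add: e fs)
qed

text \<open>The reverse inclusion is the first one applied to the product matrix with the transposes
  of \<open>a\<close> and \<open>b\<close>, which undo the multiplication and give back
  \<open>g\<close>.\<close>

lemma char_fun_inf_mult: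
  assumes a: "a \<in> O_inf" and b: "b \<in> O_inf" and g: "g \<in> fin_mats I"
    and Q: "Zp_submodule k Q" and T: "Zp_submodule k T"
  shows "char_fun_inf \<alpha> k (fin_mult (fin_mult (diag_embed k a) g) (diag_embed k b)) Q T
    = char_fun_inf \<alpha> k g Q T"
proof (rule equalityI[OF char_fun_inf_mult_subset[OF assms]])
  let ?a = "diag_embed k a" and ?b = "diag_embed k b"
  let ?at = "diag_embed k (fin_transpose a)" and ?bt = "diag_embed k (fin_transpose b)"
  let ?M = "fin_mats UNIV :: (idx \<Rightarrow> idx \<Rightarrow> 'a padic) set"
  interpret M: monoid "\<lparr>carrier = ?M, mult = fin_mult, one = fin_one\<rparr>"
    by (rule monoid_fin_mats)
  note ab = a b a[THEN O_inf_fin_transpose] b[THEN O_inf_fin_transpose]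
  have M: "?a \<in> ?M" "?b \<in> ?M" "?at \<in> ?M" "?bt \<in> ?M" "g \<in> ?M"
    using ab g fin_mats_mono[of I UNIV] by (auto intro: diag_embed_fin_mats simp: O_inf_def)
  \<comment> \<open>The second identity is orthogonality of the transpose of \<open>b\<close>, whose
    own transpose is \<open>b\<close>.\<close>
  have inv: "fin_mult ?at ?a = fin_one" "fin_mult ?b ?bt = fin_one"
    using diag_embed_orthogonal[OF a] diag_embed_orthogonal[OF ab(4)]
    by (simp_all add: diag_embed_fin_transpose)
  let ?h = "fin_mult (fin_mult ?a g) ?b"
  have h: "?h \<in> ?M" using M by (intro fin_mult_closed)
  have "fin_mult (fin_mult ?at ?h) ?bt
      = fin_mult (fin_mult (fin_mult ?at ?a) g) (fin_mult ?b ?bt)"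
    using M by (simp add: M.m_assoc[simplified] fin_mult_closed)
  also have "\<dots> = g" using M by (simp add: inv M.l_one[simplified] M.r_one[simplified])
  finally have "fin_mult (fin_mult ?at ?h) ?bt = g" .
  thus "char_fun_inf \<alpha> k g Q T \<subseteq> char_fun_inf \<alpha> k ?h Q T"
    using char_fun_inf_mult_subset[OF ab(3,4) h Q T] by simp
qed

theorem theorem4p4:
  fixes \<alpha> k m1 m2 :: nat
    and g1 g2 :: "idx \<Rightarrow> idx \<Rightarrow> ('p::prime_card) padic"
    and D :: "(idx \<Rightarrow> idx \<Rightarrow> 'p padic) set"
    and Q T :: "('p padic vec \<times> 'p padic vec) set"
  assumes "k \<ge> 1"
    and "D \<in> double_cosets (GL_inf \<alpha> k) (K_sub k)" and "g1 \<in> D" and "g2 \<in> D"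
    and "g1 \<in> carrier (GL_fin \<alpha> k m1)" and "g2 \<in> carrier (GL_fin \<alpha> k m2)"
    and "self_dual k Q" and "self_dual k T"
  shows "char_fun \<alpha> k m1 g1 Q T = char_fun \<alpha> k m2 g2 Q T"
proof -
  have QT: "Zp_submodule k Q" "Zp_submodule k T"
    using assms(7,8) by (simp_all add: self_dual_def isotropic_def)
  obtain g where g: "g \<in> carrier (GL_inf \<alpha> k)"
    and D: "D = K_sub k <#>\<^bsub>GL_inf \<alpha> k\<^esub> {g} <#>\<^bsub>GL_inf \<alpha> k\<^esub> K_sub k"
    using assms(2) by (auto simp: double_cosets_def)
  have "g \<in> fin_mats (idx_inf \<alpha> k)" using g by (simp add: GL_inf_def carrier_GL_on)
  \<comment> \<open>Every \<open>h\<close> in the double coset is a product of \<open>g\<close> with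
    embedded orthogonal matrices on both sides. Comparing through \<open>g\<close> in the size-free
    form also reconciles \<open>m1\<close> and \<open>m2\<close>.\<close>
  hence "char_fun_inf \<alpha> k h Q T = char_fun_inf \<alpha> k g Q T" if "h \<in> D" for h
    using that QT
    by (auto simp: D K_sub_def set_mult_def GL_inf_def GL_on_def units_of_def char_fun_inf_mult)
  thus ?thesis
    using char_fun_eq_char_fun_inf[OF assms(5) QT] char_fun_eq_char_fun_inf[OF assms(6) QT]
      assms(3,4) by simp
qed

end
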